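(* Let $P = \{p_1, \ldots, p_d\}$ be a finite partially ordered set and let $\mathcal{O}(P) \subset \mathbb{R}^d$ be its order polytope, with vertex set $V(\mathcal{O}(P))$ and $1$-skeleton $\mathrm{sk}(\mathcal{O}(P))$. Suppose that a subset $C \subset V(\mathcal{O}(P))$ is a $k$-clique of $\mathrm{sk}(\mathcal{O}(P))$. Then $\mathrm{conv}(C)$ is a face of $\mathcal{O}(P)$ and is a $(k-1)$-dimensional simplex.
   Context: A poset ideal of $P$ is a subset $I \subset P$ such that if $p_i \in I$ and $p_j \le p_i$, then $p_j \in I$; both $\emptyset$ and $P$ are poset ideals. Let $\mathcal{J}(P)$ be the set of all poset ideals of $P$. Let $\mathbf{e}_1, \ldots, \mathbf{e}_d$ be the canonical unit coordinate vectors of $\mathbb{R}^d$, and for $I \subset P$ put $\rho(I) = \sum_{p_i \in I} \mathbf{e}_i \in \mathbb{R}^d$ (so $\rho(\emptyset)$ is the origin). The order polytope of $P$ is the convex hull $\mathcal{O}(P) = \mathrm{conv}(\{\rho(I) : I \in \mathcal{J}(P)\})$ in $\mathbb{R}^d$. For a convex polytope $\mathcal{P}$ with vertex set $V(\mathcal{P})$, the $1$-skeleton $\mathrm{sk}(\mathcal{P})$ is the finite simple graph on $V(\mathcal{P})$ whose edges are the pairs $\{v, w\}$ with $v, w \in V(\mathcal{P})$ such that $\mathrm{conv}(\{v, w\})$ is an edge ($1$-dimensional face) of $\mathcal{P}$. A clique of $\mathrm{sk}(\mathcal{P})$ is a complete subgraph, identified with its set of vertices; a $k$-clique is a clique consisting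 of $k$ vertices. *)

theory Defs
  imports "HOL-Analysis.Analysis" "HOL-Library.Ramsey"
begin

text \<open>
  A poset is a carrier \<open>P\<close> with a relation \<open>r\<close> such that \<open>partial_order_on P r\<close>;
  \<open>(x, y) \<in> r\<close> reads \<open>x \<le> y\<close>.  An enumeration \<open>P = {p\<^sub>1, \<dots>, p\<^sub>d}\<close> is a bijection \<open>p\<close> from a
  finite index type \<open>'n\<close> (with \<open>CARD('n) = d\<close>) onto \<open>P\<close>, and \<open>real ^ 'n\<close> is the ambient space.
\<close>

definition poset_ideal :: "'a set \<Rightarrow> ('a \<times> 'a) set \<Rightarrow> 'a set \<Rightarrow> bool" where
  "poset_ideal P r I \<longleftrightarrow> I \<subseteq> P \<and> (\<forall>x\<in>I. \<forall>y\<in>P. (y, x) \<in> r \<longrightarrow> y \<in> I)"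

definition poset_ideals :: "'a set \<Rightarrow> ('a \<times> 'a) set \<Rightarrow> 'a set set" where
  "poset_ideals P r = {I. poset_ideal P r I}"

definition ideal_vec :: "('n::finite \<Rightarrow> 'a) \<Rightarrow> 'a set \<Rightarrow> real ^ 'n" where
  "ideal_vec p I = (\<Sum>i | p i \<in> I. axis i 1)"

definition order_polytope ::
    "('n::finite \<Rightarrow> 'a) \<Rightarrow> 'a set \<Rightarrow> ('a \<times> 'a) set \<Rightarrow> (real ^ 'n) set" where
  "order_polytope p P r = convex hull (ideal_vec p ` poset_ideals P r)"

definition vertices :: "'v::euclidean_space set \<Rightarrow> 'v set" where
  "vertices S = {v. v extreme_point_of S}"

text \<open>
  A graph is a pair of a vertex set and a set of two-element edge sets; in the 1-skeleton,
  \<open>v \<noteq> w\<close> is automatic, as \<open>edge_of\<close> demands affine dimension 1.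
\<close>

definition skeleton :: "'v::euclidean_space set \<Rightarrow> 'v set \<times> 'v set set" where
  "skeleton S =
     (vertices S,
      {{v, w} | v w. v \<in> vertices S \<and> w \<in> vertices S \<and> (convex hull {v, w}) edge_of S})"

definition k_clique :: "nat \<Rightarrow> 'v set \<times> 'v set set \<Rightarrow> 'v set \<Rightarrow> bool" where
  "k_clique k G C \<longleftrightarrow> C \<subseteq> fst G \<and> clique C (snd G) \<and> finite C \<and> card C = k"

end

theory Submission
  imports Defs
begin

text \<open>
  The edges of the order polytope are controlled by one observation: if \<open>A\<close>, \<open>B\<close>, \<open>I\<close>, \<open>K\<close> are ideals
  with \<open>A \<inter> B = I \<inter> K\<close> and \<open>A \<union> B = I \<union> K\<close>, then \<open>\<rho>(A) + \<rho>(B) = \<rho>(I) + \<rho>(K)\<close>, so the segments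
  \<open>[\<rho>(A), \<rho>(B)]\<close> and \<open>[\<rho>(I), \<rho>(K)]\<close> have a common midpoint.  If the second segment is a face, the
  first lies in it, and so \<open>A\<close> is \<open>I\<close> or \<open>K\<close> (\<open>face_rigid\<close>).  Such a pair \<open>I\<close>, \<open>K\<close> is called rigid
  below.  Taking \<open>A = I \<inter> K\<close> shows that rigid ideals are comparable; when \<open>I \<subseteq> K\<close>, rigidity says
  that \<open>K - I\<close> cannot be split into two parts without order relations between them, that is, that
  \<open>K - I\<close> is connected.

  A clique is therefore the image of a finite chain \<open>D\<close> of ideals.  Each member except
  the least has an element outside all smaller members, which makes the zero-one vectors affinely independent, so
  their hull is a simplex (\<open>chain_affine_independent\<close>).

  For the hull to be a face it suffices that some linear functional takes its minimum over all
  ideal vectors exactly on those of \<open>D\<close>.  The functional adds up the valid inequalities that are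
  equalities on all of \<open>D\<close>: \<open>x\<^sub>i \<ge> x\<^sub>j\<close> for relations \<open>p\<^sub>i \<le> p\<^sub>j\<close> that no member of \<open>D\<close> separates,
  \<open>x\<^sub>i \<le> 1\<close> for \<open>p\<^sub>i\<close> in every member, and \<open>x\<^sub>i \<ge> 0\<close> for \<open>p\<^sub>i\<close> in none.  An ideal \<open>J\<close> at which all of
  them are equalities lies between the least and the greatest member of \<open>D\<close> and, as differences of
  consecutive members are connected, contains each such difference or misses it.  Were \<open>J\<close> to miss
  some differences and contain a later one, connectedness of a difference of nonconsecutive
  members would give a relation from a missed element up to a contained one, which an ideal
  forbids.  So \<open>J\<close> is itself a member of \<open>D\<close> (\<open>constant_on_blocks_in_chain\<close>).
\<close>

section \<open>Zero-one vectors of ideals\<close>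

lemma ideal_vec_nth: "ideal_vec p I $ i = of_bool (p i \<in> I)"
proof -
  have "ideal_vec p I $ i = (\<Sum>j | p j \<in> I. if j = i then 1 else 0)"
    unfolding ideal_vec_def by (simp add: axis_def)
  then show ?thesis by simp
qed

lemma ideal_vec_eq_iff:
  assumes "range p = P" "I \<subseteq> P" "J \<subseteq> P"
  shows "ideal_vec p I = ideal_vec p J \<longleftrightarrow> I = J"
proof
  assume "ideal_vec p I = ideal_vec p J"
  then have "p i \<in> I \<longleftrightarrow> p i \<in> J" for i
    using ideal_vec_nth[of p I i] ideal_vec_nth[of p J i] by (auto simp: of_bool_def split: if_splits)
  then show "I = J" using assms by blast
qed simp

lemma ideal_vec_Int_Un:
  assumes "A \<inter> B = I \<inter> K" "A \<union> B = I \<union> K"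
  shows "ideal_vec p A + ideal_vec p B = ideal_vec p I + ideal_vec p K"
proof (rule vec_eq_iff[THEN iffD2], rule allI)
  fix i
  have "p i \<in> A \<and> p i \<in> B \<longleftrightarrow> p i \<in> I \<and> p i \<in> K" "p i \<in> A \<or> p i \<in> B \<longleftrightarrow> p i \<in> I \<or> p i \<in> K"
    using assms by blast+
  then show "(ideal_vec p A + ideal_vec p B) $ i = (ideal_vec p I + ideal_vec p K) $ i"
    by (auto simp: ideal_vec_nth)
qed

text \<open>
  Points of \<open>{0, 1}\<^sup>d\<close> are the vertices of a cube: a coordinate in which \<open>\<rho>(A)\<close> differs from
  \<open>\<rho>(I)\<close> forces the segment parameter to be 1.
\<close>

lemma ideal_vec_in_segment:
  assumes "ideal_vec p A \<in> closed_segment (ideal_vec p I) (ideal_vec p K)"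
  shows "ideal_vec p A = ideal_vec p I \<or> ideal_vec p A = ideal_vec p K"
proof -
  obtain u where u: "ideal_vec p A = (1 - u) *\<^sub>R ideal_vec p I + u *\<^sub>R ideal_vec p K"
    using assms by (auto simp: in_segment)
  show ?thesis
  proof (rule ccontr)
    assume *: "\<not> ?thesis"
    then obtain i where "ideal_vec p A $ i \<noteq> ideal_vec p I $ i" by (auto simp: vec_eq_iff)
    moreover have "ideal_vec p A $ i = (1 - u) * ideal_vec p I $ i + u * ideal_vec p K $ i"
      by (subst u) simp
    ultimately have "u = 1" by (auto simp: ideal_vec_nth of_bool_def split: if_splits)
    then show False using u * by simp
  qed
qed

text \<open>
  Remove the greatest member \<open>M\<close> of the chain.  An element of \<open>M\<close> outside the greatest remaining
  member \<open>N\<close> gives a coordinate that vanishes on the affine hull of the remaining vectors but not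
  at \<open>\<rho>(M)\<close>.
\<close>

lemma chain_affine_independent:
  assumes "range p = P" "finite D" "\<And>I. I \<in> D \<Longrightarrow> I \<subseteq> P"
    and "\<And>I K. I \<in> D \<Longrightarrow> K \<in> D \<Longrightarrow> I \<subseteq> K \<or> K \<subseteq> I"
  shows "\<not> affine_dependent (ideal_vec p ` D)"
  using assms(2-)
proof (induction "card D" arbitrary: D)
  case 0
  then show ?case by simp
next
  case (Suc n)
  then have "D \<noteq> {}" by auto
  then obtain M where M: "M \<in> D" "\<And>K. K \<in> D \<Longrightarrow> M \<subseteq> K \<Longrightarrow> M = K"
    using finite_has_maximal[OF Suc.prems(1)] by blast
  define E where "E = D - {M}"
  have E: "finite E" "card E = n" "D = insert M E"
    using Suc.hyps(2) Suc.prems(1) M(1) by (auto simp: E_def)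
  have ind: "\<not> affine_dependent (ideal_vec p ` E)"
    using Suc.hyps(1)[of E] Suc.prems(2,3) E by auto
  have below: "K \<subseteq> M" "K \<noteq> M" if "K \<in> E" for K
    using that Suc.prems(3)[of M K] M by (auto simp: E_def)
  have "ideal_vec p M \<notin> affine hull (ideal_vec p ` E)"
  proof (cases "E = {}")
    case False
    then obtain N where N: "N \<in> E" "\<And>K. K \<in> E \<Longrightarrow> N \<subseteq> K \<Longrightarrow> N = K"
      using finite_has_maximal[OF E(1)] by blast
    have "N \<subset> M" using below[OF N(1)] by blast
    then obtain i where i: "p i \<in> M" "p i \<notin> N"
      using assms(1) Suc.prems(2)[OF M(1)] by blast
    have "p i \<notin> K" if "K \<in> E" for K
      using i N that Suc.prems(3)[of K N] E(3) by blast
    then have "ideal_vec p ` E \<subseteq> {x. axis i 1 \<bullet> x = 0}"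
      by (auto simp: inner_axis' ideal_vec_nth)
    then have "affine hull (ideal_vec p ` E) \<subseteq> {x. axis i 1 \<bullet> x = 0}"
      by (rule hull_minimal) (rule affine_hyperplane)
    moreover have "axis i 1 \<bullet> ideal_vec p M = 1"
      using i by (simp add: inner_axis' ideal_vec_nth)
    ultimately show ?thesis by auto
  qed simp
  then show ?case
    using affine_independent_insert[OF ind] E(3) by simp
qed

section \<open>Edges\<close>

text \<open>
  The part of being an edge that the argument uses, in terms of the lattice of ideals alone.
  Intersection and union of \<open>A\<close>, \<open>B\<close> agree with those of \<open>I\<close>, \<open>K\<close> iff \<open>\<rho>(A) + \<rho>(B) = \<rho>(I) + \<rho>(K)\<close>.
\<close>

definition rigid :: "'a set \<Rightarrow> ('a \<times> 'a) set \<Rightarrow> 'a set \<Rightarrow> 'a set \<Rightarrow> bool" where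
  "rigid P r I K \<longleftrightarrow> (\<forall>A B. poset_ideal P r A \<longrightarrow> poset_ideal P r B \<longrightarrow>
     A \<inter> B = I \<inter> K \<longrightarrow> A \<union> B = I \<union> K \<longrightarrow> A = I \<or> A = K)"

lemma ideal_vec_in_order_polytope:
  "poset_ideal P r I \<Longrightarrow> ideal_vec p I \<in> order_polytope p P r"
  by (auto simp: order_polytope_def poset_ideals_def intro: hull_inc)

text \<open>
  The common midpoint of \<open>[\<rho>(A), \<rho>(B)]\<close> and \<open>[\<rho>(I), \<rho>(K)]\<close> lies in the face, which then contains
  \<open>\<rho>(A)\<close>; a zero-one vector on a segment between two such vectors is one of its ends.
\<close>

lemma face_rigid:
  assumes P: "range p = P" and I: "poset_ideal P r I" and K: "poset_ideal P r K"
    and face: "(convex hull {ideal_vec p I, ideal_vec p K}) face_of order_polytope p P r"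
  shows "rigid P r I K"
  unfolding rigid_def
proof (intro allI impI)
  fix A B
  assume A: "poset_ideal P r A" and B: "poset_ideal P r B"
    and AB: "A \<inter> B = I \<inter> K" "A \<union> B = I \<union> K"
  let ?v = "ideal_vec p"
  have mid: "midpoint (?v A) (?v B) = midpoint (?v I) (?v K)"
    using ideal_vec_Int_Un[OF AB, of p] by (simp add: midpoint_def)
  have *: "midpoint (?v A) (?v B) \<in> closed_segment (?v I) (?v K)"
    unfolding mid by simp
  have "?v A \<in> closed_segment (?v I) (?v K)"
  proof (cases "?v A = ?v B")
    case False
    then have "midpoint (?v A) (?v B) \<in> open_segment (?v A) (?v B)" by simp
    moreover have "closed_segment (?v I) (?v K) face_of order_polytope p P r"
      using face by (simp add: segment_convex_hull)
    ultimately show ?thesis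
      using face_ofD ideal_vec_in_order_polytope[OF A] ideal_vec_in_order_polytope[OF B] * by blast
  qed (use * in simp)
  then have "?v A = ?v I \<or> ?v A = ?v K" by (rule ideal_vec_in_segment)
  then show "A = I \<or> A = K"
    using ideal_vec_eq_iff[OF P] A I K by (auto simp: poset_ideal_def)
qed

lemma rigid_comparable:
  assumes "rigid P r I K" "poset_ideal P r I" "poset_ideal P r K"
  shows "I \<subseteq> K \<or> K \<subseteq> I"
proof -
  have "poset_ideal P r (I \<inter> K)" "poset_ideal P r (I \<union> K)"
    using assms(2,3) unfolding poset_ideal_def by blast+
  then have "I \<inter> K = I \<or> I \<inter> K = K"
    using assms(1)[unfolded rigid_def, rule_format, of "I \<inter> K" "I \<union> K"] by blast
  then show ?thesis by blast
qed

section \<open>Cliques\<close>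

text \<open>
  The hypotheses on \<open>J\<close> are the equality cases of the inequalities that hold with equality on
  \<open>D\<close>.  Let \<open>I\<close> be the greatest member of \<open>D\<close> inside \<open>J\<close>, and suppose \<open>J \<noteq> I\<close>.  Let \<open>K\<close> be the
  least member above \<open>I\<close> for which \<open>J \<inter> K\<close> exceeds \<open>I\<close>, and \<open>N\<close> its predecessor in the chain, so
  that \<open>J \<inter> N = I\<close>.  Rigidity of \<open>N\<close>, \<open>K\<close> puts all of \<open>K - N\<close> into \<open>J\<close>.  No element of \<open>N - I\<close> is
  then below an element of \<open>K - N\<close>, and rigidity of \<open>I\<close>, \<open>K\<close> leaves only \<open>N = I\<close>.  So \<open>K \<subseteq> J\<close>, against
  the choice of \<open>I\<close>.
\<close>

lemma constant_on_blocks_in_chain: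
  assumes fin: "finite D" and ne: "D \<noteq> {}"
    and ideal: "\<And>I. I \<in> D \<Longrightarrow> poset_ideal P r I"
    and rigid: "\<And>I K. I \<in> D \<Longrightarrow> K \<in> D \<Longrightarrow> rigid P r I K"
    and J: "poset_ideal P r J"
    and bot: "\<Inter>D \<subseteq> J" and top: "J \<subseteq> \<Union>D"
    and block: "\<And>x y. (x, y) \<in> r \<Longrightarrow> x \<in> J \<Longrightarrow> y \<in> P \<Longrightarrow>
      (\<And>I. I \<in> D \<Longrightarrow> x \<in> I \<longleftrightarrow> y \<in> I) \<Longrightarrow> y \<in> J"
  shows "J \<in> D"
proof (rule ccontr)
  assume nJ: "J \<notin> D"
  have cmp: "I \<subseteq> K \<or> K \<subseteq> I" if "I \<in> D" "K \<in> D" for I K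
    using rigid_comparable rigid ideal that by blast
  have greatest: "\<exists>M\<in>D. Q M \<and> (\<forall>K\<in>D. Q K \<longrightarrow> K \<subseteq> M)" if L: "L \<in> D" "Q L" for L Q
  proof -
    have "finite {K \<in> D. Q K}" "{K \<in> D. Q K} \<noteq> {}" using fin L by auto
    then obtain M where M: "M \<in> {K \<in> D. Q K}" "\<And>K. K \<in> {K \<in> D. Q K} \<Longrightarrow> M \<subseteq> K \<Longrightarrow> M = K"
      using finite_has_maximal[of "{K \<in> D. Q K}"] by blast
    have "K \<subseteq> M" if "K \<in> D" "Q K" for K
      using cmp[of K M] M(1) M(2)[of K] that by blast
    then show ?thesis using M(1) by blast
  qed
  have least: "\<exists>M\<in>D. Q M \<and> (\<forall>K\<in>D. Q K \<longrightarrow> M \<subseteq> K)" if L: "L \<in> D" "Q L" for L Q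
  proof -
    have "finite {K \<in> D. Q K}" "{K \<in> D. Q K} \<noteq> {}" using fin L by auto
    then obtain M where M: "M \<in> {K \<in> D. Q K}" "\<And>K. K \<in> {K \<in> D. Q K} \<Longrightarrow> K \<subseteq> M \<Longrightarrow> M = K"
      using finite_has_minimal[of "{K \<in> D. Q K}"] by blast
    have "M \<subseteq> K" if "K \<in> D" "Q K" for K
      using cmp[of K M] M(1) M(2)[of K] that by blast
    then show ?thesis using M(1) by blast
  qed
  obtain L where L: "L \<in> D" using ne by blast
  obtain I0 where I0: "I0 \<in> D" "\<And>K. K \<in> D \<Longrightarrow> I0 \<subseteq> K"
    using least[OF L, of "\<lambda>_. True"] by auto
  then have "I0 \<subseteq> J" using bot by blast
  then obtain I where I: "I \<in> D" "I \<subseteq> J" and Imax: "\<And>K. K \<in> D \<Longrightarrow> K \<subseteq> J \<Longrightarrow> K \<subseteq> I"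
    using greatest[OF I0(1), of "\<lambda>K. K \<subseteq> J"] by auto
  obtain T where T: "T \<in> D" "\<And>K. K \<in> D \<Longrightarrow> K \<subseteq> T"
    using greatest[OF L, of "\<lambda>_. True"] by auto
  have "J \<noteq> I" using nJ I(1) by blast
  have "J \<subseteq> T" using top T(2) by blast
  \<comment> \<open>The greatest member \<open>T\<close> contains \<open>J\<close>, so a \<open>K\<close> as required exists.\<close>
  then have "I \<subset> T \<and> J \<inter> T \<noteq> I"
    using I(2) \<open>J \<noteq> I\<close> by blast
  from least[OF T(1), of "\<lambda>K. I \<subset> K \<and> J \<inter> K \<noteq> I", OF this]
  obtain K where K: "K \<in> D" "I \<subset> K" "J \<inter> K \<noteq> I"
    and Kmin: "\<forall>L\<in>D. I \<subset> L \<and> J \<inter> L \<noteq> I \<longrightarrow> K \<subseteq> L"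
    by (elim bexE conjE)
  from greatest[OF I(1), of "\<lambda>L. L \<subset> K", OF K(2)]
  obtain N where N: "N \<in> D" "N \<subset> K" and Nmax: "\<forall>L\<in>D. L \<subset> K \<longrightarrow> L \<subseteq> N"
    by (elim bexE conjE)
  have IN: "I \<subseteq> N" using bspec[OF Nmax I(1)] K(2) by blast
  have JN: "J \<inter> N = I" using bspec[OF Kmin N(1)] N(2) IN I(2) by blast
  have idl: "poset_ideal P r N" "poset_ideal P r K" "poset_ideal P r I"
    using ideal N(1) K(1) I(1) by auto
  have cons: "L \<subseteq> N \<or> K \<subseteq> L" if "L \<in> D" for L
    using cmp[OF that K(1)] bspec[OF Nmax that] by blast
  \<comment> \<open>Split \<open>K - N\<close> into the parts inside and outside \<open>J\<close>.  No member of the chain lies strictly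
    between \<open>N\<close> and \<open>K\<close>, so relations within \<open>K - N\<close> are unseparated and do not leave \<open>J\<close>.\<close>
  have "poset_ideal P r (N \<union> (J \<inter> K))"
    using idl J unfolding poset_ideal_def by blast
  moreover have "poset_ideal P r (N \<union> (K - J))"
    unfolding poset_ideal_def
  proof (intro conjI ballI impI)
    fix y x assume y: "y \<in> N \<union> (K - J)" and x: "x \<in> P" "(x, y) \<in> r"
    show "x \<in> N \<union> (K - J)"
    proof (rule ccontr)
      assume nx: "x \<notin> N \<union> (K - J)"
      then have "y \<notin> N" using x idl(1) unfolding poset_ideal_def by blast
      then have y': "y \<in> K" "y \<notin> J" "y \<in> P" using y idl(2) unfolding poset_ideal_def by auto
      then have x': "x \<in> K" "x \<notin> N" "x \<in> J" using nx x idl(2) unfolding poset_ideal_def by auto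
      have "x \<in> L \<longleftrightarrow> y \<in> L" if "L \<in> D" for L
        using cons[OF that] x' y' \<open>y \<notin> N\<close> by blast
      then show False using block[OF x(2) x'(3) y'(3)] y'(2) by blast
    qed
  qed (use idl in \<open>auto simp: poset_ideal_def\<close>)
  ultimately have "N \<union> (J \<inter> K) = N \<or> N \<union> (J \<inter> K) = K"
    using rigid[OF N(1) K(1), unfolded rigid_def, rule_format, of "N \<union> (J \<inter> K)" "N \<union> (K - J)"] N(2)
    by blast
  then have KJ: "K - N \<subseteq> J" using K I(2) JN by blast
  \<comment> \<open>Whatever lies below \<open>K - N\<close> is in \<open>J\<close>, and \<open>J\<close> meets \<open>N\<close> only in \<open>I\<close>.\<close>
  have "poset_ideal P r (I \<union> (K - N))"
    unfolding poset_ideal_def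
  proof (intro conjI ballI impI)
    fix y x assume y: "y \<in> I \<union> (K - N)" and x: "x \<in> P" "(x, y) \<in> r"
    have "y \<in> K" "y \<in> J" using y KJ K(2) I(2) by blast+
    then have "x \<in> K" "x \<in> J" using x idl(2) J unfolding poset_ideal_def by blast+
    then show "x \<in> I \<union> (K - N)" using JN by blast
  qed (use idl in \<open>auto simp: poset_ideal_def\<close>)
  moreover have "N \<inter> (I \<union> (K - N)) = I \<inter> K" "N \<union> (I \<union> (K - N)) = I \<union> K"
    using IN N(2) by blast+
  ultimately have "N = I \<or> N = K"
    using rigid[OF I(1) K(1), unfolded rigid_def, rule_format, OF idl(1), of "I \<union> (K - N)"]
    by blast
  then have "K \<subseteq> J" using KJ N(2) I(2) by blast
  then show False using Imax[OF K(1)] K(2) by blast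
qed

lemma convex_hull_face_of_if_minimizers:
  fixes a :: "'v::euclidean_space"
  assumes "finite S" "T \<subseteq> S" "\<And>x. x \<in> T \<Longrightarrow> a \<bullet> x = b" "\<And>x. x \<in> S - T \<Longrightarrow> a \<bullet> x > b"
  shows "(convex hull T) face_of (convex hull S)"
proof (rule face_of_convex_hulls)
  have "affine hull T \<subseteq> {x. a \<bullet> x = b}"
    using assms(3) by (intro hull_minimal affine_hyperplane) auto
  moreover have "convex hull (S - T) \<subseteq> {x. a \<bullet> x > b}"
    using assms(4) by (intro hull_minimal convex_halfspace_gt) auto
  ultimately show "affine hull T \<inter> convex hull (S - T) = {}" by fastforce
qed (use assms in auto)

text \<open>
  In the proof, \<open>U\<close> collects the relations that no member of \<open>D\<close> separates, \<open>S\<close> the indices of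
  elements common to all members, and \<open>Z\<close> those of elements in none.  The functional
  \<open>a\<close> is the sum of the slacks \<open>x\<^sub>i - x\<^sub>j\<close>, \<open>1 - x\<^sub>i\<close> and \<open>x\<^sub>i\<close> over these sets, up to the additive
  constant \<open>card S\<close>.  The slacks are nonnegative at every ideal vector and vanish on \<open>D\<close>; by
  \<open>constant_on_blocks_in_chain\<close> they vanish together at no other ideal.
\<close>

lemma rigid_family_face:
  fixes p :: "'n::finite \<Rightarrow> 'a"
  assumes P: "range p = P" and ne: "D \<noteq> {}"
    and ideal: "\<And>I. I \<in> D \<Longrightarrow> poset_ideal P r I"
    and rigid: "\<And>I K. I \<in> D \<Longrightarrow> K \<in> D \<Longrightarrow> rigid P r I K"
  shows "(convex hull (ideal_vec p ` D)) face_of order_polytope p P r"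
proof -
  let ?v = "ideal_vec p"
  have finP: "finite P" using P by (metis finite finite_imageI)
  have "poset_ideals P r \<subseteq> Pow P" by (auto simp: poset_ideals_def poset_ideal_def)
  then have finI: "finite (poset_ideals P r)" using finP by (simp add: finite_subset)
  have DI: "D \<subseteq> poset_ideals P r" using ideal by (auto simp: poset_ideals_def)
  have finD: "finite D" using finI DI finite_subset by blast
  define U where "U = {(i, j). (p i, p j) \<in> r \<and> (\<forall>I\<in>D. p i \<in> I \<longleftrightarrow> p j \<in> I)}"
  define S where "S = {i. \<forall>I\<in>D. p i \<in> I}"
  define Z where "Z = {i. \<forall>I\<in>D. p i \<notin> I}"
  define a :: "real ^ 'n" where
    "a = (\<Sum>ij\<in>U. axis (fst ij) 1 - axis (snd ij) 1) - (\<Sum>i\<in>S. axis i 1) + (\<Sum>i\<in>Z. axis i 1)"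
  have inner: "a \<bullet> ?v J = (\<Sum>ij\<in>U. of_bool (p (fst ij) \<in> J) - of_bool (p (snd ij) \<in> J))
      + (\<Sum>i\<in>S. 1 - of_bool (p i \<in> J)) + (\<Sum>i\<in>Z. of_bool (p i \<in> J)) - real (card S)" for J
  proof -
    have "a \<bullet> ?v J = (\<Sum>ij\<in>U. of_bool (p (fst ij) \<in> J) - of_bool (p (snd ij) \<in> J))
        - (\<Sum>i\<in>S. of_bool (p i \<in> J)) + (\<Sum>i\<in>Z. of_bool (p i \<in> J))"
      unfolding a_def inner_add_left inner_diff_left inner_sum_left
      by (simp only: inner_diff_left inner_axis' ideal_vec_nth mult_1_left real_inner_1_left inner_real_def)
    then show ?thesis by (simp add: sum_subtractf)
  qed
  have tU: "0 \<le> (of_bool (p (fst ij) \<in> J) - of_bool (p (snd ij) \<in> J) :: real)"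
    if "poset_ideal P r J" "ij \<in> U" for J ij
    using that P by (auto simp: U_def poset_ideal_def)
  have "(convex hull (?v ` D)) face_of (convex hull (?v ` poset_ideals P r))"
  proof (rule convex_hull_face_of_if_minimizers[where a = a and b = "- real (card S)"])
    show "a \<bullet> x = - real (card S)" if x: "x \<in> ?v ` D" for x
    proof -
      obtain I where I: "I \<in> D" "x = ?v I" using x by blast
      have "(\<Sum>ij\<in>U. of_bool (p (fst ij) \<in> I) - of_bool (p (snd ij) \<in> I) :: real) = 0"
        using I(1) by (intro sum.neutral) (auto simp: U_def)
      moreover have "(\<Sum>i\<in>S. 1 - of_bool (p i \<in> I) :: real) = 0" "(\<Sum>i\<in>Z. of_bool (p i \<in> I) :: real) = 0"
        using I(1) by (auto intro!: sum.neutral simp: S_def Z_def)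
      ultimately show ?thesis unfolding I(2) inner by linarith
    qed
    show "a \<bullet> x > - real (card S)" if x: "x \<in> ?v ` poset_ideals P r - ?v ` D" for x
    proof (rule ccontr)
      assume le: "\<not> a \<bullet> x > - real (card S)"
      obtain J where J: "poset_ideal P r J" "x = ?v J" "J \<notin> D"
        using x by (auto simp: poset_ideals_def)
      let ?u = "\<Sum>ij\<in>U. of_bool (p (fst ij) \<in> J) - of_bool (p (snd ij) \<in> J) :: real"
      let ?s = "\<Sum>i\<in>S. 1 - of_bool (p i \<in> J) :: real"
      let ?z = "\<Sum>i\<in>Z. of_bool (p i \<in> J) :: real"
      have "0 \<le> ?u" using tU[OF J(1)] by (intro sum_nonneg) auto
      moreover have "0 \<le> ?s" "0 \<le> ?z" by (auto intro!: sum_nonneg)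
      ultimately have 0: "?u = 0" "?s = 0" "?z = 0"
        using le unfolding J(2) inner by linarith+
      have u: "p i \<in> J \<longleftrightarrow> p j \<in> J" if "(i, j) \<in> U" for i j
      proof -
        have "of_bool (p (fst ij) \<in> J) - of_bool (p (snd ij) \<in> J) = (0 :: real)" if "ij \<in> U" for ij
          using sum_nonneg_0[OF finite tU[OF J(1)] 0(1) that] by simp
        from this[OF that] show ?thesis by (simp add: of_bool_def split: if_splits)
      qed
      have s: "p i \<in> J" if "i \<in> S" for i
      proof -
        have "1 - of_bool (p i \<in> J) = (0 :: real)"
          by (rule sum_nonneg_0[OF finite _ 0(2) that]) simp
        then show ?thesis by (simp add: of_bool_def split: if_splits)
      qed
      have z: "p i \<notin> J" if "i \<in> Z" for i
      proof -
        have "of_bool (p i \<in> J) = (0 :: real)"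
          by (rule sum_nonneg_0[OF finite _ 0(3) that]) simp
        then show ?thesis by (simp add: of_bool_def split: if_splits)
      qed
      have "J \<in> D"
      proof (rule constant_on_blocks_in_chain[OF finD ne ideal rigid J(1)])
        show "\<Inter>D \<subseteq> J"
        proof
          fix y assume y: "y \<in> \<Inter>D"
          then have "y \<in> P" using ne ideal by (auto simp: poset_ideal_def)
          then obtain i where "y = p i" using P by blast
          then show "y \<in> J" using s[of i] y by (auto simp: S_def)
        qed
        show "J \<subseteq> \<Union>D"
        proof
          fix y assume y: "y \<in> J"
          then obtain i where "y = p i" using P J(1) by (auto simp: poset_ideal_def)
          then show "y \<in> \<Union>D" using z[of i] y by (auto simp: Z_def)
        qed
        show "y \<in> J" if xy: "(x, y) \<in> r" "x \<in> J" "y \<in> P" "\<And>I. I \<in> D \<Longrightarrow> x \<in> I \<longleftrightarrow> y \<in> I" for x y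
        proof -
          obtain i j where "x = p i" "y = p j" using xy(2,3) P J(1) by (auto simp: poset_ideal_def)
          then show ?thesis using u[of i j] xy by (auto simp: U_def)
        qed
      qed
      then show False using J(3) by blast
    qed
  qed (use finI DI in auto)
  then show ?thesis by (simp add: order_polytope_def)
qed

theorem theorem2p5:
  fixes P :: "'a set"
    and r :: "('a \<times> 'a) set"
    and p :: "'n::finite \<Rightarrow> 'a"
    and k :: nat
    and C :: "(real ^ 'n) set"
  assumes "partial_order_on P r"
    and "bij_betw p UNIV P"
    and "C \<subseteq> vertices (order_polytope p P r)"
    and "k_clique k (skeleton (order_polytope p P r)) C"
  shows "(convex hull C) face_of (order_polytope p P r) \<and> (int k - 1) simplex (convex hull C)"
proof -
  let ?v = "ideal_vec p" and ?O = "order_polytope p P r"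
  have P: "range p = P" using assms(2) by (simp add: bij_betw_def)
  have "C \<subseteq> ?v ` poset_ideals P r"
    using assms(3) extreme_point_of_convex_hull
    unfolding vertices_def order_polytope_def by blast
  then obtain D where "D \<subseteq> poset_ideals P r" and C: "C = ?v ` D"
    by (meson subset_imageE)
  then have ideal: "poset_ideal P r I" if "I \<in> D" for I
    using that by (auto simp: poset_ideals_def)
  have inj: "I = K" if "I \<in> D" "K \<in> D" "?v I = ?v K" for I K
    using that ideal ideal_vec_eq_iff[OF P] by (auto simp: poset_ideal_def)
  have k: "finite C" "card C = k" and cl: "clique C (snd (skeleton ?O))"
    using assms(4) by (auto simp: k_clique_def)
  have finD: "finite D" using k(1) inj unfolding C by (auto intro: finite_imageD inj_onI)
  have rigid: "rigid P r I K" if IK: "I \<in> D" "K \<in> D" for I K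
  proof (cases "I = K")
    case False
    then have "{?v I, ?v K} \<in> snd (skeleton ?O)"
      using cl IK inj unfolding clique_def C by blast
    then obtain v w where "{?v I, ?v K} = {v, w}" "(convex hull {v, w}) edge_of ?O"
      by (auto simp: skeleton_def)
    then have "(convex hull {?v I, ?v K}) face_of ?O" by (simp add: edge_of_def)
    then show ?thesis using face_rigid[OF P] ideal IK by blast
  qed (auto simp: rigid_def)
  have "(convex hull C) face_of ?O"
  proof (cases "D = {}")
    case False
    then show ?thesis unfolding C using rigid_family_face[OF P] ideal rigid by blast
  qed (simp add: C)
  moreover have "\<not> affine_dependent C"
    unfolding C
  proof (rule chain_affine_independent[OF P finD])
    show "I \<subseteq> P" if "I \<in> D" for I using ideal[OF that] by (simp add: poset_ideal_def)
    show "I \<subseteq> K \<or> K \<subseteq> I" if "I \<in> D" "K \<in> D" for I K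
      using rigid_comparable rigid ideal that by blast
  qed
  ultimately show ?thesis using k by (auto simp: simplex_def)
qed

end
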